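(* Let $K\subsetneq L$ be a field extension such that $L$ has the linear matching property (over $K$) and $\#K\geq 5$. Then there exists $m\in\mathbb{N}$ such that $K\subset L$ fails to have the linear acyclic matching property at order $m$.
   Context: $\mathbb{N}$ is the set of positive integers and $\#K$ is the cardinality of $K$. Let $K\subseteq L$ be a field extension and let $A,B$ be $n$-dimensional $K$-subspaces of $L$, $n\ge 1$. Let $\mathcal{A}=\{a_1,\ldots,a_n\}$ and $\mathcal{B}=\{b_1,\ldots,b_n\}$ be (ordered) bases of $A$ and $B$. $\mathcal{A}$ is matched to $\mathcal{B}$ if for all $b\in B$ and all $i=1,\ldots,n$: $a_ib\in A$ implies $b\in\langle b_1,\ldots,\hat{b}_i,\ldots,b_n\rangle$, the $K$-span of $\mathcal{B}\setminus\{b_i\}$. The subspace $A$ is matched with $B$ if every basis $\mathcal{A}$ of $A$ can be matched to some basis $\mathcal{B}$ of $B$. $L$ has the linear matching property (over $K$) if, for every $n\geq 1$ and every pair of $n$-dimensional $K$-subspaces $A,B$ of $L$ with $1\notin B$, the subspace $A$ is matched with $B$. A strong matching from $A$ to $B$ is a $K$-linear isomorphism $\varphi:A\to B$ such that any basis $\mathcal{A}=\{a_1,\dots,a_n\}$ of $A$ is matched to the basis $\varphi(\mathcal{A})=\{\varphi(a_1),\dots,\varphi(a_n)\}$ of $B$. For strong matchings $f,g:A\to B$, write $f\sim g$ if there exists a $K$-linear isomorphism $\varphi:A\to A$ such that $a f(a)=\varphi(a)\,g(\varphi(a))$ for all $a\in A$. The extension $K\subseteq L$ fails to have the linear acyclic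 matching property at order $m\in\mathbb{N}$ if there exist $K$-subspaces $A,B$ of $L$ and strong matchings $f,g:A\to B$ such that $f\neq g$, $f\sim g$ and $\dim_K A=\dim_K B=m$. *)

theory Defs
  imports "HOL-Algebra.Algebra"
begin

text \<open>
  The extension is a subfield K of an ambient field R. Its K-subspaces of dimension n are the
  sets A with dimension n K A, and lists serve as ordered bases, indexed from 0.
\<close>

definition (in ring) ordered_basis :: "'a set \<Rightarrow> 'a set \<Rightarrow> 'a list \<Rightarrow> bool"
  where "ordered_basis K A as \<longleftrightarrow> independent K as \<and> Span K as = A"

text \<open>The list take i bs @ drop (Suc i) bs is bs with its entry number i omitted.\<close>

definition (in ring) basis_matched :: "'a set \<Rightarrow> 'a set \<Rightarrow> 'a set \<Rightarrow> 'a list \<Rightarrow> 'a list \<Rightarrow> bool"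
  where "basis_matched K A B as bs \<longleftrightarrow>
    (\<forall>b\<in>B. \<forall>i<length as. as ! i \<otimes> b \<in> A \<longrightarrow> b \<in> Span K (take i bs @ drop (Suc i) bs))"

definition (in ring) subspace_matched :: "'a set \<Rightarrow> 'a set \<Rightarrow> 'a set \<Rightarrow> bool"
  where "subspace_matched K A B \<longleftrightarrow>
    (\<forall>as. ordered_basis K A as \<longrightarrow> (\<exists>bs. ordered_basis K B bs \<and> basis_matched K A B as bs))"

definition (in ring) linear_matching_property :: "'a set \<Rightarrow> bool"
  where "linear_matching_property K \<longleftrightarrow>
    (\<forall>n\<ge>1. \<forall>A B. dimension n K A \<and> dimension n K B \<and> \<one> \<notin> B \<longrightarrow> subspace_matched K A B)"

definition (in ring) linear_iso :: "'a set \<Rightarrow> 'a set \<Rightarrow> 'a set \<Rightarrow> ('a \<Rightarrow> 'a) \<Rightarrow> bool"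
  where "linear_iso K A B \<phi> \<longleftrightarrow> bij_betw \<phi> A B \<and>
    (\<forall>x\<in>A. \<forall>y\<in>A. \<phi> (x \<oplus> y) = \<phi> x \<oplus> \<phi> y) \<and>
    (\<forall>k\<in>K. \<forall>x\<in>A. \<phi> (k \<otimes> x) = k \<otimes> \<phi> x)"

definition (in ring) strong_matching :: "'a set \<Rightarrow> 'a set \<Rightarrow> 'a set \<Rightarrow> ('a \<Rightarrow> 'a) \<Rightarrow> bool"
  where "strong_matching K A B \<phi> \<longleftrightarrow> linear_iso K A B \<phi> \<and>
    (\<forall>as. ordered_basis K A as \<longrightarrow> basis_matched K A B as (map \<phi> as))"

definition (in ring) matching_equiv :: "'a set \<Rightarrow> 'a set \<Rightarrow> ('a \<Rightarrow> 'a) \<Rightarrow> ('a \<Rightarrow> 'a) \<Rightarrow> bool"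
  where "matching_equiv K A f g \<longleftrightarrow>
    (\<exists>\<phi>. linear_iso K A A \<phi> \<and> (\<forall>a\<in>A. a \<otimes> f a = \<phi> a \<otimes> g (\<phi> a)))"

text \<open>
  Maps from A to B are total functions whose values outside A are irrelevant, so f and g differ
  as maps on A only if they differ at some point of A.
\<close>

definition (in ring) fails_linear_acyclic_matching :: "'a set \<Rightarrow> nat \<Rightarrow> bool"
  where "fails_linear_acyclic_matching K m \<longleftrightarrow>
    (\<exists>A B f g. dimension m K A \<and> dimension m K B \<and>
       strong_matching K A B f \<and> strong_matching K A B g \<and>
       (\<exists>a\<in>A. f a \<noteq> g a) \<and> matching_equiv K A f g)"

end

theory Submission
  imports Defs
begin

text \<open>
  Order one suffices. Take $A = K$ and $B = Kb$ with $b \notin K$; every nonzero multiple of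
  $x \mapsto xb$ is a strong matching because $Kb \cap K = 0$. For a scalar $d \neq 0$ the
  substitution $x \mapsto dx$ turns $x \cdot xb$ into $x \cdot d^2 xb$, so $x \mapsto xb$ and
  $x \mapsto d^2 xb$ are equivalent, and they are distinct as soon as $d \neq \pm 1$.
\<close>

text \<open>Every span contains zero, while each entry of an independent list avoids the span of the
  later ones. This makes the entries of a basis of \<open>K\<close> cancellable.\<close>

lemma (in ring) zero_notin_independent:
  assumes "subfield K R" and "independent K us"
  shows "\<zero> \<notin> set us"
  using assms(2)
proof (induction us rule: list.induct)
  case (Cons u us)
  have ind: "independent K us" and u: "u \<notin> Span K us"
    using independent_backwards[OF Cons.prems] by auto
  have "\<zero> \<in> Span K us"
    using Span_is_add_subgroup[OF assms(1) independent_in_carrier[OF ind]]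
      subgroup.one_closed by fastforce
  with u Cons.IH[OF ind] show ?case by auto
qed simp

context field
begin

text \<open>A nonzero \<open>x\<close> could be cancelled inside \<open>K\<close>, which would put
  \<open>b\<close> into \<open>K\<close>. In other words, the line through \<open>b\<close> meets
  \<open>K\<close> only in zero.\<close>

lemma subfield_mult_eq_zero_if_inter:
  assumes K: "subfield K R" and b: "b \<in> carrier R" "b \<notin> K"
    and x: "x \<in> K" and xb: "x \<otimes> b \<in> K"
  shows "x = \<zero>"
proof (rule ccontr)
  assume "x \<noteq> \<zero>"
  then have i: "inv x \<in> K" "inv x \<otimes> x = \<one>"
    using subfield_m_inv[OF K] x by auto
  have "inv x \<otimes> (x \<otimes> b) = b"
    using i b x subfieldE(3)[OF K] by (simp add: m_assoc[symmetric] subsetD)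
  then show False
    using subringE(6)[OF subfieldE(1)[OF K] i(1) xb] b by simp
qed

lemma dimension_one_image:
  assumes K: "subfield K R" and b: "b \<in> carrier R" "b \<noteq> \<zero>"
  shows "dimension 1 K ((\<lambda>x. x \<otimes> b) ` K)"
proof -
  \<comment> \<open>The line is the zero space extended by one vector outside it, so
    \<open>Suc_dim\<close> yields its dimension.\<close>
  have "line_extension K b {\<zero>} = (\<lambda>x. x \<otimes> b) ` K"
    using b subfieldE(3)[OF K] by (force simp: line_extension_mem_iff)
  then show ?thesis
    using Suc_dim[OF b(1) _ zero_dim, of K] b(2) by simp
qed

text \<open>The only \<open>y\<close> in the target with \<open>as ! i \<otimes> y\<close> in
  \<open>K\<close> is zero, which lies in every span, so the matching condition holds for any basis.
  The factor \<open>c\<close> is free so that both maps of the counterexample are covered.\<close>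

lemma strong_matching_mult:
  assumes K: "subfield K R" and b: "b \<in> carrier R" "b \<notin> K"
    and c: "c \<in> K" "c \<noteq> \<zero>"
  shows "strong_matching K K ((\<lambda>x. x \<otimes> b) ` K) (\<lambda>x. c \<otimes> (x \<otimes> b))"
proof -
  note KR = subsetD[OF subfieldE(3)[OF K]]
  note mult_K = subringE(6)[OF subfieldE(1)[OF K]]
  have b0: "b \<noteq> \<zero>"
    using b subringE(2)[OF subfieldE(1)[OF K]] by auto
  have ic: "inv c \<in> K" "c \<otimes> inv c = \<one>"
    using subfield_m_inv[OF K] c by auto
  have inj: "inj_on (\<lambda>x. c \<otimes> (x \<otimes> b)) K"
    using KR b b0 c by (auto intro!: inj_onI simp: m_lcancel m_rcancel)
  have "(\<lambda>x. c \<otimes> (x \<otimes> b)) ` K = (\<lambda>x. x \<otimes> b) ` K" (is "?l = ?r")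
  proof (intro equalityI image_subsetI)
    fix x assume "x \<in> K"
    then show "c \<otimes> (x \<otimes> b) \<in> ?r"
      using KR b c mult_K by (auto intro!: image_eqI[of _ _ "c \<otimes> x"] simp: m_assoc)
    have "x \<otimes> b = c \<otimes> (inv c \<otimes> x \<otimes> b)"
      using KR ic b c \<open>x \<in> K\<close> by (simp add: m_assoc[symmetric])
    then show "x \<otimes> b \<in> ?l"
      using mult_K ic \<open>x \<in> K\<close> by blast
  qed
  with inj have bij: "bij_betw (\<lambda>x. c \<otimes> (x \<otimes> b)) K ((\<lambda>x. x \<otimes> b) ` K)"
    by (simp add: bij_betw_def)
  have iso: "linear_iso K K ((\<lambda>x. x \<otimes> b) ` K) (\<lambda>x. c \<otimes> (x \<otimes> b))"
    unfolding linear_iso_def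
    using bij KR b c by (auto simp: l_distr r_distr m_ac)
  have "basis_matched K K ((\<lambda>x. x \<otimes> b) ` K) as (map (\<lambda>x. c \<otimes> (x \<otimes> b)) as)"
    if "ordered_basis K K as" for as
    unfolding basis_matched_def
  proof (intro ballI allI impI)
    fix y i
    assume y: "y \<in> (\<lambda>x. x \<otimes> b) ` K" and i: "i < length as" and ay: "as ! i \<otimes> y \<in> K"
    have ind: "independent K as" and span: "Span K as = K"
      using that by (auto simp: ordered_basis_def)
    have sub: "set as \<subseteq> K"
      using Span_base_incl[OF K independent_in_carrier[OF ind]] span by simp
    have a: "as ! i \<in> K" "as ! i \<noteq> \<zero>"
      using sub nth_mem[OF i] zero_notin_independent[OF K ind] by (blast, metis)
    obtain x where x: "x \<in> K" "y = x \<otimes> b"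
      using y by blast
    \<comment> \<open>The product of \<open>as ! i\<close> and \<open>y\<close> is
      \<open>(as ! i \<otimes> x) \<otimes> b\<close>, which lies both in \<open>K\<close> and on
      the line through \<open>b\<close>.\<close>
    have "as ! i \<otimes> x = \<zero>"
      using subfield_mult_eq_zero_if_inter[OF K b mult_K[OF a(1) x(1)]] ay KR a x b
      by (simp add: m_assoc)
    then have "y = \<zero>"
      using a x KR b integral by fastforce
    moreover
    let ?bs = "map (\<lambda>x. c \<otimes> (x \<otimes> b)) as"
    \<comment> \<open>Spans are known to be additive subgroups, hence to contain zero, only for
      lists over the carrier.\<close>
    have "set ?bs \<subseteq> carrier R"
      using sub KR b c by auto
    then have "set (take i ?bs @ drop (Suc i) ?bs) \<subseteq> carrier R"
      using set_take_subset[of i ?bs] set_drop_subset[of "Suc i" ?bs] by fastforce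
    ultimately show "y \<in> Span K (take i ?bs @ drop (Suc i) ?bs)"
      using subgroup.one_closed[OF Span_is_add_subgroup[OF K]] by fastforce
  qed
  with iso show ?thesis
    by (simp add: strong_matching_def)
qed

lemma linear_iso_mult:
  assumes K: "subfield K R" and d: "d \<in> K" "d \<noteq> \<zero>"
  shows "linear_iso K K K ((\<otimes>) d)"
proof -
  note KR = subsetD[OF subfieldE(3)[OF K]]
  note mult_K = subringE(6)[OF subfieldE(1)[OF K]]
  have inv_d: "inv d \<in> K" "inv d \<otimes> d = \<one>" "d \<otimes> inv d = \<one>"
    using subfield_m_inv[OF K] d by auto
  have "bij_betw ((\<otimes>) d) K K"
    by (rule bij_betwI[where g = "(\<otimes>) (inv d)"])
      (use inv_d d KR mult_K in \<open>auto simp: m_assoc[symmetric]\<close>)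
  then show ?thesis
    unfolding linear_iso_def using KR d by (auto simp: r_distr m_ac)
qed

lemma fails_linear_acyclic_matching_one:
  assumes K: "subfield K R" and "K \<subset> carrier R"
    and d: "d \<in> K" "d \<noteq> \<zero>" "d \<noteq> \<one>" "d \<noteq> \<ominus> \<one>"
  shows "fails_linear_acyclic_matching K 1"
proof -
  note KR = subsetD[OF subfieldE(3)[OF K]]
  note subring = subfieldE(1)[OF K]
  obtain b where b: "b \<in> carrier R" "b \<notin> K"
    using assms(2) by blast
  have b0: "b \<noteq> \<zero>"
    using b subringE(2)[OF subring] by auto
  have dd: "d \<otimes> d \<in> K" "d \<otimes> d \<noteq> \<zero>"
    using d KR integral subringE(6)[OF subring] by auto
  \<comment> \<open>In a field the only square roots of one are \<open>\<one>\<close> and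
    \<open>\<ominus> \<one>\<close>.\<close>
  have "d \<otimes> d \<noteq> \<one>"
    using square_eq_one[of d] d KR by auto
  \<comment> \<open>The two maps are told apart at \<open>a = \<one>\<close>, where cancelling
    \<open>b\<close> leaves \<open>d \<otimes> d\<close> against \<open>\<one>\<close>.\<close>
  then have "d \<otimes> d \<otimes> (\<one> \<otimes> b) \<noteq> \<one> \<otimes> (\<one> \<otimes> b)"
    using m_rcancel[OF b0 b(1) KR[OF dd(1)] one_closed] b by simp
  then have neq: "\<exists>a\<in>K. d \<otimes> d \<otimes> (a \<otimes> b) \<noteq> \<one> \<otimes> (a \<otimes> b)"
    using subringE(3)[OF subring] by blast
  \<comment> \<open>The equivalence is witnessed by multiplication by \<open>d\<close>. The factor
    \<open>\<one>\<close> on the right keeps the second map in the form of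
    \<open>strong_matching_mult\<close> with \<open>c = \<one>\<close>.\<close>
  have "x \<otimes> (d \<otimes> d \<otimes> (x \<otimes> b)) = d \<otimes> x \<otimes> (\<one> \<otimes> (d \<otimes> x \<otimes> b))" if "x \<in> K" for x
    using that d KR b by (simp add: m_ac)
  then have "matching_equiv K K (\<lambda>x. d \<otimes> d \<otimes> (x \<otimes> b)) (\<lambda>x. \<one> \<otimes> (x \<otimes> b))"
    unfolding matching_equiv_def using linear_iso_mult[OF K d(1,2)] by blast
  then show ?thesis
    unfolding fails_linear_acyclic_matching_def
    using dimension_one[OF K] dimension_one_image[OF K b(1) b0]
      strong_matching_mult[OF K b dd]
      strong_matching_mult[OF K b subringE(3)[OF subring] one_not_zero] neq
    by blast
qed

end

theorem theorem5p6:
  fixes L :: "('a, 'b) ring_scheme" and K :: "'a set"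
  assumes "field L" and "subfield K L" and "K \<subset> carrier L"
    and "ring.linear_matching_property L K"
    and "infinite K \<or> card K \<ge> 5"
  shows "\<exists>m::nat. m \<ge> 1 \<and> ring.fails_linear_acyclic_matching L K m"
proof -
  interpret field L by fact
  \<comment> \<open>These are the values that \<open>d\<close> must avoid. In characteristic 2 the
    last two coincide, so the cardinality is only bounded by 3.\<close>
  let ?S = "{\<zero>\<^bsub>L\<^esub>, \<one>\<^bsub>L\<^esub>, \<ominus>\<^bsub>L\<^esub> \<one>\<^bsub>L\<^esub>}"
  have "card ?S \<le> 3"
    by (simp add: card_insert_if)
  then have "\<not> K \<subseteq> ?S"
    using assms(5) card_mono[of ?S K] finite_subset[of K ?S] by auto
  then obtain d where "d \<in> K" "d \<notin> ?S"
    by blast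
  then show ?thesis
    using fails_linear_acyclic_matching_one[OF assms(2,3)] by auto
qed

end
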